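(* Let $X$ be a finite chain (linearly ordered set) with $|X|>1$, let $K$ be a field, and let $\varphi$ be a Lie automorphism of $I(X,K)$. Then $\varphi$ is a regular Hom-Lie structure on $I(X,K)$ if and only if $\varphi=\xi_\beta+\nu$, where $\nu:I(X,K)\to I(X,K)$ is a unique linear map with values in the center of $I(X,K)$ and with $\nu(J(I(X,K)))=0$, and $\beta$ is - a unique element of $I(X,K)^*$ satisfying $\beta_D=\delta$ and $\beta_J\in Z(J(I(X,K)))$, if $|X|>2$; - an arbitrary element of $I(X,K)^*$, if $|X|=2$.
   Context: $I(X,K)$ is the incidence algebra: the $K$-algebra with basis $\{e_{xy}: x\le y\}$ and product $e_{xy}e_{uv}=e_{xv}$ if $y=u$ and $0$ otherwise (for a chain with $n$ elements it is the algebra of upper triangular $n\times n$ matrices over $K$); $e_x:=e_{xx}$; $\delta=\sum_{x\in X}e_x$ is the identity; $I(X,K)^*$ is the group of units. $J(I(X,K))=\mathrm{Span}_K\{e_{xy}:x<y\}$ is the Jacobson radical and $Z(J(I(X,K)))$ is its center, equal to $\mathrm{Span}_K\{e_{xy}:x<y,\ x \text{ minimal in } X,\ y\text{ maximal in }X\}$. $D(X,K)=\mathrm{Span}_K\{e_x:x\in X\}$; each $f\in I(X,K)$ is uniquely $f=f_D+f_J$ with $f_D\in D(X,K)$, $f_J\in J(I(X,K))$. $I(X,K)$ is regarded as a Lie algebra with $[f,g]=fg-gf$; a Lie automorphism is a linear bijection preserving $[\cdot,\cdot]$. The center of $I(X,K)$ is $K\delta$. $\xi_\beta(f)=\beta f\beta^{-1}$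 for $\beta\in I(X,K)^*$. A regular Hom-Lie structure on a Lie algebra $L$ is an automorphism $\varphi$ of the Lie algebra $L$ satisfying $[[a,b],\varphi(c)]+[[b,c],\varphi(a)]+[[c,a],\varphi(b)]=0$ for all $a,b,c\in L$. *)

theory Defs
  imports Complex_Main "HOL-Library.Cardinality"
begin

text \<open>
  The poset is the carrier of a type of class \<open>order\<close>; a finite chain is a type of sort
  \<open>{finite, linorder}\<close>.  An element of the incidence algebra is given by its
  coefficients with respect to the basis \<open>e\<^sub>x\<^sub>y\<close> (\<open>x \<le> y\<close>), extended by \<open>0\<close> to all pairs.
\<close>

typedef (overloaded) ('x::order, 'k::zero) incidence =
  "{f :: 'x \<Rightarrow> 'x \<Rightarrow> 'k. \<forall>x y. \<not> x \<le> y \<longrightarrow> f x y = 0}"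
  morphisms inc_coeff Abs_incidence
  by (rule exI[of _ "\<lambda>_ _. 0"]) simp

setup_lifting type_definition_incidence

lemma incidence_eqI: "(\<And>x y. inc_coeff f x y = inc_coeff g x y) \<Longrightarrow> f = g"
  by (metis ext inc_coeff_inject)

lemma inc_coeff_zero: "\<not> x \<le> y \<Longrightarrow> inc_coeff f x y = 0"
  using inc_coeff[of f] by simp

instantiation incidence :: ("{finite, order}", field) ring_1
begin

lift_definition zero_incidence :: "('a, 'b) incidence" is "\<lambda>_ _. 0" by simp

lift_definition one_incidence :: "('a, 'b) incidence" is "\<lambda>x y. if x = y then 1 else 0"
  by auto

lift_definition plus_incidence ::
    "('a, 'b) incidence \<Rightarrow> ('a, 'b) incidence \<Rightarrow> ('a, 'b) incidence"
  is "\<lambda>f g x y. f x y + g x y" by simp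

lift_definition minus_incidence ::
    "('a, 'b) incidence \<Rightarrow> ('a, 'b) incidence \<Rightarrow> ('a, 'b) incidence"
  is "\<lambda>f g x y. f x y - g x y" by simp

lift_definition uminus_incidence :: "('a, 'b) incidence \<Rightarrow> ('a, 'b) incidence"
  is "\<lambda>f x y. - f x y" by simp

text \<open>Only the terms with \<open>x \<le> z \<le> y\<close> contribute to the sum.\<close>

lift_definition times_incidence ::
    "('a, 'b) incidence \<Rightarrow> ('a, 'b) incidence \<Rightarrow> ('a, 'b) incidence"
  is "\<lambda>f g x y. \<Sum>z\<in>UNIV. f x z * g z y"
  by (smt (verit) mult_eq_0_iff order_trans sum.neutral)

instance
proof
  fix a b c :: "('a, 'b) incidence"
  show "a * b * c = a * (b * c)"
  proof (transfer, intro ext)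
    fix a b c :: "'a \<Rightarrow> 'a \<Rightarrow> 'b" and x y
    have "(\<Sum>z\<in>UNIV. (\<Sum>w\<in>UNIV. a x w * b w z) * c z y)
        = (\<Sum>z\<in>UNIV. \<Sum>w\<in>UNIV. a x w * (b w z * c z y))"
      by (simp add: sum_distrib_right mult.assoc)
    also have "\<dots> = (\<Sum>w\<in>UNIV. \<Sum>z\<in>UNIV. a x w * (b w z * c z y))"
      by (rule sum.swap)
    also have "\<dots> = (\<Sum>w\<in>UNIV. a x w * (\<Sum>z\<in>UNIV. b w z * c z y))"
      by (simp add: sum_distrib_left)
    finally show "(\<Sum>z\<in>UNIV. (\<Sum>w\<in>UNIV. a x w * b w z) * c z y)
        = (\<Sum>w\<in>UNIV. a x w * (\<Sum>z\<in>UNIV. b w z * c z y))" .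
  qed
  show "1 * a = a"
    by (transfer, intro ext) (simp add: if_distrib[of "\<lambda>t. t * _"] cong: if_cong)
  show "a * 1 = a"
    by (transfer, intro ext) (simp add: if_distrib[of "\<lambda>t. _ * t"] cong: if_cong)
  show "(a + b) * c = a * c + b * c"
    by (transfer, intro ext) (simp add: distrib_right sum.distrib)
  show "a * (b + c) = a * b + a * c"
    by (transfer, intro ext) (simp add: distrib_left sum.distrib)
  show "(0 :: ('a, 'b) incidence) \<noteq> 1"
    by transfer (simp add: fun_eq_iff)
  show "a + b + c = a + (b + c)" by (transfer, intro ext) (simp add: add.assoc)
  show "a + b = b + a" by (transfer, intro ext) (simp add: add.commute)
  show "0 + a = a" by (transfer, intro ext) simp
  show "- a + a = 0" by (transfer, intro ext) simp
  show "a - b = a + - b" by (transfer, intro ext) simp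
qed

end

lift_definition inc_scale ::
    "'k::field \<Rightarrow> ('x::{finite,order}, 'k) incidence \<Rightarrow> ('x, 'k) incidence"
  is "\<lambda>c f x y. c * f x y" by simp

interpretation inc: vector_space inc_scale
  by unfold_locales (transfer, simp add: algebra_simps)+

lemma inc_scale_mult:
  "inc_scale c (f * g) = inc_scale c f * g" "inc_scale c (f * g) = f * inc_scale c g"
  by (transfer, intro ext, simp add: sum_distrib_left mult_ac)+

text \<open>\<open>inc_e x y\<close> is the basis element \<open>e\<^sub>x\<^sub>y\<close>; it is only meaningful for \<open>x \<le> y\<close>, and \<open>0\<close> otherwise.\<close>

lift_definition inc_e :: "'x \<Rightarrow> 'x \<Rightarrow> ('x::{finite,order}, 'k::field) incidence"
  is "\<lambda>x y u v. if x \<le> y \<and> u = x \<and> v = y then 1 else 0" by auto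

lemma inc_coeff_simps [simp]:
  "inc_coeff 0 x y = 0"
  "inc_coeff 1 x y = (if x = y then 1 else 0)"
  "inc_coeff (f + g) x y = inc_coeff f x y + inc_coeff g x y"
  "inc_coeff (f - g) x y = inc_coeff f x y - inc_coeff g x y"
  "inc_coeff (- f) x y = - inc_coeff f x y"
  "inc_coeff (f * g) x y = (\<Sum>z\<in>UNIV. inc_coeff f x z * inc_coeff g z y)"
  "inc_coeff (inc_scale c f) x y = c * inc_coeff f x y"
  "inc_coeff (inc_e u v) x y = (if u \<le> v \<and> x = u \<and> y = v then 1 else 0)"
  by (transfer, simp)+

lemma inc_e_mult:
  assumes "x \<le> y" "u \<le> v"
  shows "inc_e x y * inc_e u v = (if y = u then inc_e x v else 0)"
proof (rule incidence_eqI)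
  fix a b
  have "(\<Sum>z\<in>UNIV. (if a = x \<and> z = y then 1 else 0) * (if z = u \<and> b = v then 1 else (0::'b)))
      = (\<Sum>z\<in>UNIV. if z = y then (if a = x \<and> y = u \<and> b = v then 1 else 0) else 0)"
    by (rule sum.cong) auto
  also have "\<dots> = (if a = x \<and> y = u \<and> b = v then 1 else 0)" by simp
  finally show "inc_coeff (inc_e x y * inc_e u v :: ('a, 'b) incidence) a b
      = inc_coeff (if y = u then inc_e x v else 0) a b"
    using assms by (simp split: if_splits) blast
qed

definition inc_diag :: "('x::{finite,order}, 'k::field) incidence set" where
  "inc_diag = inc.span {inc_e x x | x. True}"

definition inc_rad :: "('x::{finite,order}, 'k::field) incidence set" where
  "inc_rad = inc.span {inc_e x y | x y. x < y}"

definition ring_center :: "'a::times set \<Rightarrow> 'a set" where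
  "ring_center A = {z \<in> A. \<forall>a\<in>A. z * a = a * z}"

text \<open>The two components of the decomposition \<open>f = f\<^sub>D + f\<^sub>J\<close>; they are well defined by
  \<open>inc_decomposition\<close> below.\<close>

definition inc_D :: "('x::{finite,order}, 'k::field) incidence \<Rightarrow> ('x, 'k) incidence" where
  "inc_D f = (THE d. d \<in> inc_diag \<and> f - d \<in> inc_rad)"

definition inc_J :: "('x::{finite,order}, 'k::field) incidence \<Rightarrow> ('x, 'k) incidence" where
  "inc_J f = f - inc_D f"

lemma inc_coeff_sum: "inc_coeff (sum h A) x y = (\<Sum>a\<in>A. inc_coeff (h a) x y)"
  by (induction A rule: infinite_finite_induct) auto

lemma inc_diag_iff: "f \<in> inc_diag \<longleftrightarrow> (\<forall>x y. x \<noteq> y \<longrightarrow> inc_coeff f x y = 0)"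
proof
  assume "f \<in> inc_diag"
  then show "\<forall>x y. x \<noteq> y \<longrightarrow> inc_coeff f x y = 0"
    unfolding inc_diag_def by (induction rule: inc.span_induct_alt) (auto split: if_splits)
next
  assume f: "\<forall>x y. x \<noteq> y \<longrightarrow> inc_coeff f x y = 0"
  have "f = (\<Sum>x\<in>UNIV. inc_scale (inc_coeff f x x) (inc_e x x))"
  proof (rule incidence_eqI)
    fix a b
    have "(\<Sum>x\<in>UNIV. inc_coeff f x x * (if a = x \<and> b = x then 1 else 0))
        = (\<Sum>x\<in>UNIV. if x = a then (if b = a then inc_coeff f a a else 0) else 0)"
      by (rule sum.cong) auto
    then show "inc_coeff f a b
        = inc_coeff (\<Sum>x\<in>UNIV. inc_scale (inc_coeff f x x) (inc_e x x)) a b"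
      using f by (auto simp: inc_coeff_sum)
  qed
  moreover have "\<dots> \<in> inc_diag"
    unfolding inc_diag_def
    by (intro inc.span_sum inc.span_scale inc.span_base) auto
  ultimately show "f \<in> inc_diag" by simp
qed

lemma inc_rad_iff: "f \<in> inc_rad \<longleftrightarrow> (\<forall>x. inc_coeff f x x = 0)"
proof
  assume "f \<in> inc_rad"
  then show "\<forall>x. inc_coeff f x x = 0"
    unfolding inc_rad_def by (induction rule: inc.span_induct_alt) (auto split: if_splits)
next
  assume f: "\<forall>x. inc_coeff f x x = 0"
  let ?P = "{(x, y). x < y}"
  have "f = (\<Sum>(x, y)\<in>?P. inc_scale (inc_coeff f x y) (inc_e x y))"
  proof (rule incidence_eqI)
    fix a b
    have "(\<Sum>p\<in>?P. inc_coeff (case p of (x, y) \<Rightarrow> inc_scale (inc_coeff f x y) (inc_e x y)) a b)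
        = (\<Sum>p\<in>?P. if p = (a, b) then inc_coeff f a b else 0)"
      by (rule sum.cong) (auto split: if_splits)
    also have "\<dots> = (if a < b then inc_coeff f a b else 0)"
      by (simp add: sum.delta)
    also have "\<dots> = inc_coeff f a b"
      using f inc_coeff_zero[of a b f] by (auto simp: less_le)
    finally show "inc_coeff f a b
        = inc_coeff (\<Sum>(x, y)\<in>?P. inc_scale (inc_coeff f x y) (inc_e x y)) a b"
      by (simp add: inc_coeff_sum)
  qed
  moreover have "\<dots> \<in> inc_rad"
    unfolding inc_rad_def
    by (intro inc.span_sum) (auto simp: split_beta intro!: inc.span_scale[OF inc.span_base])
  ultimately show "f \<in> inc_rad" by simp
qed

lemma inc_decomposition: "\<exists>!d. d \<in> inc_diag \<and> f - d \<in> inc_rad"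
proof (rule ex1I)
  let ?d = "Abs_incidence (\<lambda>x y. if x = y then inc_coeff f x y else 0)"
  have d: "inc_coeff ?d x y = (if x = y then inc_coeff f x y else 0)" for x y
    by (subst Abs_incidence_inverse) auto
  show "?d \<in> inc_diag \<and> f - ?d \<in> inc_rad"
    by (simp add: inc_diag_iff inc_rad_iff d)
  show "d' = ?d" if "d' \<in> inc_diag \<and> f - d' \<in> inc_rad" for d'
    using that by (intro incidence_eqI) (auto simp: inc_diag_iff inc_rad_iff d)
qed

definition ring_units :: "'a::monoid_mult set" where
  "ring_units = {u. \<exists>v. u * v = 1 \<and> v * u = 1}"

definition ring_inv :: "'a::monoid_mult \<Rightarrow> 'a" where
  "ring_inv u = (THE v. u * v = 1 \<and> v * u = 1)"

lemma ring_inv: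
  assumes "u \<in> ring_units"
  shows "u * ring_inv u = 1" "ring_inv u * u = 1"
proof -
  obtain v where v: "u * v = 1" "v * u = 1"
    using assms by (auto simp: ring_units_def)
  have "w = v" if "u * w = 1" for w
    using v that by (metis mult.assoc mult_1_left mult_1_right)
  with v have "ring_inv u = v"
    unfolding ring_inv_def by blast
  with v show "u * ring_inv u = 1" "ring_inv u * u = 1" by auto
qed

definition conj_by :: "'a::monoid_mult \<Rightarrow> 'a \<Rightarrow> 'a" where
  "conj_by \<beta> f = \<beta> * f * ring_inv \<beta>"

definition lie_automorphism ::
    "('k::field \<Rightarrow> 'l \<Rightarrow> 'l) \<Rightarrow> ('l::ab_group_add \<Rightarrow> 'l \<Rightarrow> 'l) \<Rightarrow> ('l \<Rightarrow> 'l) \<Rightarrow> bool" where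
  "lie_automorphism scale brk \<phi> \<longleftrightarrow>
     Vector_Spaces.linear scale scale \<phi> \<and> bij \<phi> \<and> (\<forall>a b. \<phi> (brk a b) = brk (\<phi> a) (\<phi> b))"

definition regular_hom_lie ::
    "('k::field \<Rightarrow> 'l \<Rightarrow> 'l) \<Rightarrow> ('l::ab_group_add \<Rightarrow> 'l \<Rightarrow> 'l) \<Rightarrow> ('l \<Rightarrow> 'l) \<Rightarrow> bool" where
  "regular_hom_lie scale brk \<phi> \<longleftrightarrow>
     lie_automorphism scale brk \<phi> \<and>
     (\<forall>a b c. brk (brk a b) (\<phi> c) + brk (brk b c) (\<phi> a) + brk (brk c a) (\<phi> b) = 0)"

definition commutator :: "'a::ring \<Rightarrow> 'a \<Rightarrow> 'a" where
  "commutator f g = f * g - g * f"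

definition central_radfree ::
    "(('x::{finite,order}, 'k::field) incidence \<Rightarrow> ('x, 'k) incidence) \<Rightarrow> bool" where
  "central_radfree \<nu> \<longleftrightarrow>
     Vector_Spaces.linear inc_scale inc_scale \<nu> \<and>
     (\<forall>f. \<nu> f \<in> ring_center UNIV) \<and> (\<forall>f\<in>inc_rad. \<nu> f = 0)"

end

theory Submission
  imports Defs
begin

text \<open>
  Write \<open>E = e\<^sub>x\<^sub>y\<close> for the least \<open>x\<close> and the greatest \<open>y\<close>. For \<open>|X| > 2\<close> the Hom-Lie identity,
  applied to \<open>e\<^sub>i\<close>, \<open>e\<^sub>j\<close> and \<open>e\<^sub>k\<^sub>l\<close>, shows that \<open>\<phi>(e\<^sub>j)\<close> commutes with \<open>e\<^sub>k\<^sub>l\<close> for \<open>j \<notin> {k, l}\<close> and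
  \<open>\<phi>(e\<^sub>i) + \<phi>(e\<^sub>j)\<close> with \<open>e\<^sub>i\<^sub>j\<close>. Hence the diagonal of \<open>\<phi>(e\<^sub>j)\<close> is that of \<open>t e\<^sub>j\<close> plus a scalar, where
  \<open>t\<close> does not depend on \<open>j\<close>, and \<open>t = 1\<close> since \<open>[\<phi>(e\<^sub>x), \<phi>(E)] = \<phi>(E)\<close> with \<open>\<phi>(E) \<noteq> 0\<close> in the radical.
  Together with \<open>[\<phi>(e\<^sub>i), \<phi>(e\<^sub>j)] = 0\<close> this kills all entries off the diagonal except the one at \<open>E\<close>, so
  \<open>\<phi>(e\<^sub>j)\<close> acts on the radical as \<open>e\<^sub>j\<close> does. So \<open>\<phi>(e\<^sub>k\<^sub>l)\<close> is a multiple of \<open>e\<^sub>k\<^sub>l\<close>, and the Hom-Lie identity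
  makes the factor \<open>1\<close>. Conversely, if \<open>\<phi>\<close> differs from the identity by elements that commute with the
  radical, then the Hom-Lie identity is the Jacobi identity. For \<open>|X| = 2\<close> the radical is \<open>K E\<close>, so only
  diagonals matter and every Lie automorphism qualifies.
\<close>

section \<open>Entries of products\<close>

declare inc_coeff_simps(6) [simp del]

text \<open>The general product rule, just removed from the simpset, turns every product into a sum
  over \<open>UNIV\<close>; this rule and its mirror image keep products with basis elements free of
  sums.\<close>

lemma inc_coeff_mult_e [simp]:
  "inc_coeff (f * inc_e x y) a b = (if x \<le> y \<and> b = y then inc_coeff f a x else 0)"
proof -
  have "(\<Sum>z\<in>UNIV. inc_coeff f a z * inc_coeff (inc_e x y) z b)
      = (\<Sum>z\<in>UNIV. if z = x then (if x \<le> y \<and> b = y then inc_coeff f a x else 0) else 0)"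
    by (rule sum.cong) auto
  then show ?thesis by (simp add: inc_coeff_simps(6))
qed

lemma inc_coeff_e_mult [simp]:
  "inc_coeff (inc_e x y * f) a b = (if x \<le> y \<and> a = x then inc_coeff f y b else 0)"
proof -
  have "(\<Sum>z\<in>UNIV. inc_coeff (inc_e x y) a z * inc_coeff f z b)
      = (\<Sum>z\<in>UNIV. if z = y then (if x \<le> y \<and> a = x then inc_coeff f y b else 0) else 0)"
    by (rule sum.cong) auto
  then show ?thesis by (simp add: inc_coeff_simps(6))
qed

lemma inc_coeff_mult_diag: "inc_coeff (f * g) a a = inc_coeff f a a * inc_coeff g a a"
proof -
  have "(\<Sum>z\<in>UNIV. inc_coeff f a z * inc_coeff g z a)
      = (\<Sum>z\<in>UNIV. if z = a then inc_coeff f a a * inc_coeff g a a else 0)"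
    by (rule sum.cong) (auto, metis inc_coeff_zero order_antisym)
  then show ?thesis by (simp add: inc_coeff_simps(6))
qed

text \<open>Splits off the two terms that involve diagonal entries; in the applications the sum over
  the open interval vanishes.\<close>

lemma inc_coeff_mult_less:
  assumes "a < b"
  shows "inc_coeff (f * g) a b
    = inc_coeff f a a * inc_coeff g a b + inc_coeff f a b * inc_coeff g b b
      + (\<Sum>z\<in>{a<..<b}. inc_coeff f a z * inc_coeff g z b)"
proof -
  have "(\<Sum>z\<in>UNIV. inc_coeff f a z * inc_coeff g z b)
      = (\<Sum>z\<in>insert a (insert b {a<..<b}). inc_coeff f a z * inc_coeff g z b)"
    by (rule sum.mono_neutral_right) (auto simp: inc_coeff_zero less_le)
  then show ?thesis using assms by (simp add: inc_coeff_simps(6) add.assoc)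
qed

section \<open>Commutators with basis elements\<close>

lemma commutator_zero [simp]: "commutator 0 f = 0" "commutator f 0 = 0"
  by (simp_all add: commutator_def)

lemma commutator_swap: "commutator g f = - commutator f g"
  by (simp add: commutator_def)

lemma commutator_eq_0_iff: "commutator f g = 0 \<longleftrightarrow> f * g = g * f"
  by (simp add: commutator_def)

lemma commutator_uminus [simp]:
  "commutator (- f) g = - commutator f g" "commutator f (- g) = - commutator f g"
  by (simp_all add: commutator_def)

lemma commutator_scale:
  "commutator (inc_scale c f) g = inc_scale c (commutator f g)"
  "commutator f (inc_scale c g) = inc_scale c (commutator f g)"
  by (simp_all add: commutator_def inc.scale_right_diff_distrib flip: inc_scale_mult)

lemma commutator_in_rad: "commutator f g \<in> inc_rad"
  by (simp add: commutator_def inc_rad_iff inc_coeff_mult_diag)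

lemma commutator_e_diag:
  "commutator (inc_e i i) (inc_e k l)
    = (if k = l then 0 else if i = k then inc_e k l else if i = l then - inc_e k l else 0)"
  by (rule incidence_eqI) (auto simp: commutator_def)

lemma commutator_e_diag_right:
  "commutator (inc_e k l) (inc_e i i)
    = (if k = l then 0 else if i = k then - inc_e k l else if i = l then inc_e k l else 0)"
  by (subst commutator_swap) (simp add: commutator_e_diag)

lemma commutator_e_e:
  assumes "i < j" "k < l" "i \<noteq> l"
  shows "commutator (inc_e i j) (inc_e k l) = (if j = k then inc_e i l else 0)"
  using assms
  by (intro incidence_eqI) (auto simp: commutator_def)

lemma inc_coeff_commutator_e_diag:
  "inc_coeff (commutator (inc_e i i) f) a b
    = (if a = i then inc_coeff f a b else 0) - (if b = i then inc_coeff f a b else 0)"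
  by (simp add: commutator_def)

text \<open>One product is column \<open>x\<close> of \<open>f\<close> moved to column
  \<open>y\<close>, the other is row \<open>y\<close> of \<open>f\<close> moved to row
  \<open>x\<close>; they can agree only at \<open>(x, y)\<close>. This turns commutation relations
  into statements about entries.\<close>

lemma commute_e_iff:
  assumes "x \<le> y"
  shows "f * inc_e x y = inc_e x y * f \<longleftrightarrow>
    (\<forall>a. a \<noteq> x \<longrightarrow> inc_coeff f a x = 0) \<and> (\<forall>b. b \<noteq> y \<longrightarrow> inc_coeff f y b = 0)
      \<and> inc_coeff f x x = inc_coeff f y y" (is "?L \<longleftrightarrow> ?R")
proof
  assume ?L
  then have "inc_coeff (f * inc_e x y) a b = inc_coeff (inc_e x y * f) a b" for a b
    by simp
  then have *: "(if b = y then inc_coeff f a x else 0) = (if a = x then inc_coeff f y b else 0)"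
    for a b using assms by (simp)
  show ?R using *[of y] *[of _ x] *[of y x] by (metis (full_types))
next
  assume ?R then show ?L
    using assms by (intro incidence_eqI) (auto)
qed

section \<open>Linear maps, eigenvectors in the radical, and conjugation\<close>

lemma inc_e_span: "inc.span {inc_e x y | x y. x \<le> y} = UNIV"
proof -
  have "f \<in> inc.span {inc_e x y | x y. x \<le> y}"
    for f :: "('x::{finite,order}, 'k::field) incidence"
  proof -
    obtain d where d: "d \<in> inc_diag" "f - d \<in> inc_rad"
      using inc_decomposition by blast
    have "d \<in> inc.span {inc_e x y | x y. x \<le> y}"
      using d(1) inc.span_mono[of "{inc_e x x |x. True}" "{inc_e x y | x y. x \<le> y}"]
      by (auto simp: inc_diag_def)
    moreover have "f - d \<in> inc.span {inc_e x y | x y. x \<le> y}"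
      using d(2) inc.span_mono[of "{inc_e x y |x y. x < y}" "{inc_e x y | x y. x \<le> y}"]
      by (auto simp: inc_rad_def intro: less_imp_le)
    ultimately have "d + (f - d) \<in> inc.span {inc_e x y | x y. x \<le> y}"
      by (rule inc.span_add)
    then show ?thesis by simp
  qed
  then show ?thesis by auto
qed

lemma linear_inc_eqI:
  fixes \<phi> \<psi> :: "('x::{finite,order}, 'k::field) incidence \<Rightarrow> ('x, 'k) incidence"
  assumes "Vector_Spaces.linear inc_scale inc_scale \<phi>" "Vector_Spaces.linear inc_scale inc_scale \<psi>"
    and "\<And>x. \<phi> (inc_e x x) = \<psi> (inc_e x x)"
    and "\<And>x y. x < y \<Longrightarrow> \<phi> (inc_e x y) = \<psi> (inc_e x y)"
  shows "\<phi> = \<psi>"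
proof
  fix f :: "('x, 'k) incidence"
  interpret vs: vector_space_pair
    "inc_scale :: 'k \<Rightarrow> ('x, 'k) incidence \<Rightarrow> _" "inc_scale :: 'k \<Rightarrow> ('x, 'k) incidence \<Rightarrow> _" ..
  have "f \<in> inc.span {inc_e x y | x y. x \<le> y}"
    by (simp add: inc_e_span)
  then show "\<phi> f = \<psi> f"
    by (rule vs.linear_eq_on[OF assms(1,2)]) (auto simp: assms(3,4) le_less)
qed

text \<open>Look at a nonzero entry \<open>g\<^sub>a\<^sub>b\<close> with \<open>{a..b}\<close> of least size: the intermediate terms vanish.\<close>

lemma eigenvalue_commutator:
  assumes "g \<in> inc_rad" "g \<noteq> 0" "commutator f g = g"
  obtains a b where "a < b" "inc_coeff f a a - inc_coeff f b b = 1"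
proof -
  have "\<exists>p. inc_coeff g (fst p) (snd p) \<noteq> 0"
    using assms(2) incidence_eqI[of g 0] by auto
  then obtain p where p: "inc_coeff g (fst p) (snd p) \<noteq> 0"
    and least: "\<And>q. inc_coeff g (fst q) (snd q) \<noteq> 0 \<Longrightarrow>
      card {fst p..snd p} \<le> card {fst q..snd q}"
    using ex_has_least_nat[of "\<lambda>p. inc_coeff g (fst p) (snd p) \<noteq> 0" _ "\<lambda>p. card {fst p..snd p}"]
    by metis
  obtain a b where ab: "p = (a, b)" by fastforce
  have "a \<le> b" "a \<noteq> b"
    using p assms(1) inc_coeff_zero[of a b g] by (auto simp: ab inc_rad_iff)
  then have "a < b" by simp
  have mid: "inc_coeff g c d = 0" if "{c..d} \<subset> {a..b}" for c d
    using least[of "(c, d)"] psubset_card_mono[OF _ that] by (force simp: ab)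
  have "inc_coeff (commutator f g) a b
      = (inc_coeff f a a - inc_coeff f b b) * inc_coeff g a b"
  proof -
    have "inc_coeff g a z = 0" "inc_coeff g z b = 0" if "z \<in> {a<..<b}" for z
      using that by (auto intro!: mid)
    moreover have "inc_coeff g a a = 0" "inc_coeff g b b = 0"
      using assms(1) by (auto simp: inc_rad_iff)
    ultimately show ?thesis
      using \<open>a < b\<close>
      by (simp add: commutator_def inc_coeff_mult_less algebra_simps)
  qed
  then have "inc_coeff f a a - inc_coeff f b b = 1"
    using p assms(3) by (simp add: ab)
  with \<open>a < b\<close> show thesis by (rule that)
qed


lemma linear_inc_iff:
  fixes \<phi> :: "('x::{finite,order}, 'k::field) incidence \<Rightarrow> ('x, 'k) incidence"
  shows "Vector_Spaces.linear inc_scale inc_scale \<phi> \<longleftrightarrow>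
    (\<forall>f g. \<phi> (f + g) = \<phi> f + \<phi> g) \<and> (\<forall>c f. \<phi> (inc_scale c f) = inc_scale c (\<phi> f))"
  by (simp add: Vector_Spaces.linear_iff inc.vector_space_axioms)

lemma inc_D_eqI: "d \<in> inc_diag \<Longrightarrow> f - d \<in> inc_rad \<Longrightarrow> inc_D f = d"
  unfolding inc_D_def using the1_equality[OF inc_decomposition] by blast

text \<open>Lets conjugates be identified without computing an inverse.\<close>

lemma conj_by_eqI:
  assumes "\<beta> \<in> ring_units" "\<beta> * f = g * \<beta>"
  shows "conj_by \<beta> f = g"
  using assms ring_inv[OF assms(1)] by (simp add: conj_by_def mult.assoc)

text \<open>Diagonal entries are multiplicative, so those of \<beta> and of its inverse
  cancel.\<close>

lemma inc_coeff_conj_by_diag: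
  assumes "\<beta> \<in> ring_units"
  shows "inc_coeff (conj_by \<beta> f) a a = inc_coeff f a a"
proof -
  have "inc_coeff \<beta> a a * inc_coeff (ring_inv \<beta>) a a = 1"
    using ring_inv(1)[OF assms] by (metis inc_coeff_mult_diag inc_coeff_simps(2))
  then show ?thesis
    by (simp add: conj_by_def inc_coeff_mult_diag algebra_simps)
qed

lemma linear_conj_by: "Vector_Spaces.linear inc_scale inc_scale (conj_by \<beta>)"
  unfolding linear_inc_iff conj_by_def
  by (simp add: distrib_left distrib_right flip: inc_scale_mult)

section \<open>Extreme elements of the chain and the two centers\<close>

definition bt :: "'x::{finite,linorder}" where "bt = Min UNIV"
definition tp :: "'x::{finite,linorder}" where "tp = Max UNIV"

lemma bt_le [simp]: "bt \<le> x" and le_tp [simp]: "x \<le> tp"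
  by (simp_all add: bt_def tp_def)

lemma bt_less_iff: "bt < x \<longleftrightarrow> x \<noteq> bt" and less_tp_iff: "x < tp \<longleftrightarrow> x \<noteq> tp"
  using bt_le[of x] le_tp[of x] by (auto simp: less_le)

lemma not_less_bt [simp]: "\<not> x < bt" and not_tp_less [simp]: "\<not> tp < x"
  by (simp_all add: not_less)

lemma inc_coeff_tp_bt [simp]:
  "c \<noteq> tp \<Longrightarrow> inc_coeff f tp c = 0" "c \<noteq> bt \<Longrightarrow> inc_coeff f c bt = 0"
  by (simp_all add: inc_coeff_zero not_le less_tp_iff bt_less_iff)

lemma bt_less_tp:
  assumes "CARD('x::{finite,linorder}) > 1"
  shows "(bt :: 'x) < tp" "(bt :: 'x) \<noteq> tp" "(tp :: 'x) \<noteq> bt"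
proof -
  show "(bt :: 'x) < tp"
  proof (rule ccontr)
    assume "\<not> (bt :: 'x) < tp"
    then have "x = bt" for x :: 'x
      using bt_le[of x] le_tp[of x] by (metis leI order.antisym order.trans)
    then have "(UNIV :: 'x set) = {bt}" by blast
    then have "CARD('x) = 1" by (metis card_1_singleton_iff One_nat_def)
    with assms show False by simp
  qed
  then show "(bt :: 'x) \<noteq> tp" "(tp :: 'x) \<noteq> bt" by auto
qed

text \<open>Commuting with e_b kills column \<open>b\<close> off the diagonal, and commuting with
  the element from \<open>a\<close> to \<open>tp\<close> makes all diagonal entries equal.\<close>

lemma ring_center_inc:
  "ring_center UNIV = range (\<lambda>c. inc_scale c (1 :: ('x::{finite,linorder}, 'k::field) incidence))"
proof (intro set_eqI iffI)
  fix z :: "('x, 'k) incidence"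
  assume "z \<in> ring_center UNIV"
  then have *: "z * inc_e x y = inc_e x y * z" for x y
    by (auto simp: ring_center_def)
  have off: "inc_coeff z a b = 0" if "a \<noteq> b" for a b
    using that *[of b b] by (subst (asm) commute_e_iff) auto
  have "inc_coeff z a a = inc_coeff z tp tp" for a
    using *[of a tp] by (subst (asm) commute_e_iff) auto
  with off have "z = inc_scale (inc_coeff z tp tp) 1"
    by (intro incidence_eqI) auto
  then show "z \<in> range (\<lambda>c. inc_scale c 1)" by blast
next
  fix z :: "('x, 'k) incidence"
  assume "z \<in> range (\<lambda>c. inc_scale c 1)"
  then show "z \<in> ring_center UNIV"
    by (auto simp: ring_center_def simp flip: inc_scale_mult)
qed

text \<open>Commuting with \<open>inc_e bt a\<close> kills row \<open>a\<close> off the diagonal,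
  and commuting with \<open>inc_e b tp\<close> kills column \<open>b\<close>, so only the corner
  entry survives. Conversely row \<open>tp\<close> and column \<open>bt\<close> of a radical element
  are zero, so its products with the corner element vanish on both sides.\<close>

lemma ring_center_inc_rad:
  assumes "CARD('x::{finite,linorder}) > 1"
  shows "ring_center inc_rad = range (\<lambda>b. inc_scale b (inc_e bt tp :: ('x, 'k::field) incidence))"
proof (intro set_eqI iffI)
  fix z :: "('x, 'k) incidence"
  assume z: "z \<in> ring_center inc_rad"
  have *: "z * inc_e x y = inc_e x y * z" if "x < y" for x y
  proof -
    have "inc_e x y \<in> (inc_rad :: ('x, 'k) incidence set)"
      using that by (auto simp: inc_rad_iff)
    with z show ?thesis by (auto simp: ring_center_def)
  qed
  have "inc_coeff z a b = 0" if "a \<noteq> bt \<or> b \<noteq> tp" for a b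
  proof (cases "a = b")
    case True
    then show ?thesis using z by (auto simp: ring_center_def inc_rad_iff)
  next
    case False
    then show ?thesis
      using that *[of bt a] *[of b tp] by (auto simp: bt_less_iff less_tp_iff commute_e_iff)
  qed
  then have "z = inc_scale (inc_coeff z bt tp) (inc_e bt tp)"
    by (intro incidence_eqI) auto
  then show "z \<in> range (\<lambda>b. inc_scale b (inc_e bt tp))" by blast
next
  fix z :: "('x, 'k) incidence"
  assume "z \<in> range (\<lambda>b. inc_scale b (inc_e bt tp))"
  then obtain b where z: "z = inc_scale b (inc_e bt tp)" by blast
  have "z * f = f * z" if "f \<in> inc_rad" for f
  proof -
    have "inc_coeff f tp c = 0" "inc_coeff f c bt = 0" for c
      using that inc_coeff_tp_bt[of c f] by (metis inc_rad_iff)+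
    then show ?thesis
      by (intro incidence_eqI) (auto simp: z simp flip: inc_scale_mult)
  qed
  moreover have "z \<in> inc_rad"
    using bt_less_tp[OF assms] by (auto simp: z inc_rad_iff)
  ultimately show "z \<in> ring_center inc_rad" by (auto simp: ring_center_def)
qed

lemma
  fixes f :: "('x::{finite,linorder}, 'k::field) incidence"
  shows bt_tp_mult: "inc_e bt tp * f = inc_scale (inc_coeff f tp tp) (inc_e bt tp)"
    and mult_bt_tp: "f * inc_e bt tp = inc_scale (inc_coeff f bt bt) (inc_e bt tp)"
  by (intro incidence_eqI; force)+

section \<open>Conjugation by normalized units\<close>

text \<open>Reduces the choice of a normalized \<beta> to the choice of one scalar
  \<open>b\<close>.\<close>

lemma normalized_iff:
  fixes \<beta> :: "('x::{finite,linorder}, 'k::field) incidence"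
  assumes "CARD('x) > 1"
  shows "inc_D \<beta> = 1 \<and> inc_J \<beta> \<in> ring_center inc_rad \<longleftrightarrow>
    (\<exists>b. \<beta> = 1 + inc_scale b (inc_e bt tp))"
proof
  assume L: "inc_D \<beta> = 1 \<and> inc_J \<beta> \<in> ring_center inc_rad"
  then obtain b where b: "\<beta> - 1 = inc_scale b (inc_e bt tp)"
    unfolding ring_center_inc_rad[OF assms] inc_J_def by (metis imageE)
  show "\<exists>b. \<beta> = 1 + inc_scale b (inc_e bt tp)"
    using b
    by (intro exI[of _ b]) (simp add: diff_eq_eq add.commute)
next
  assume "\<exists>b. \<beta> = 1 + inc_scale b (inc_e bt tp)"
  then obtain b where b: "\<beta> = 1 + inc_scale b (inc_e bt tp)" by blast
  have "inc_D \<beta> = 1"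
    using bt_less_tp[OF assms] by (intro inc_D_eqI) (auto simp: b inc_diag_iff inc_rad_iff)
  then show "inc_D \<beta> = 1 \<and> inc_J \<beta> \<in> ring_center inc_rad"
    by (auto simp: inc_J_def b ring_center_inc_rad[OF assms])
qed

lemma unipotent_unit:
  assumes "CARD('x::{finite,linorder}) > 1"
  shows "1 + inc_scale b (inc_e bt tp) \<in> (ring_units :: ('x, 'k::field) incidence set)"
proof -
  let ?E = "inc_e bt tp :: ('x, 'k) incidence"
  have "?E * ?E = 0"
    using bt_less_tp[OF assms] by (simp add: inc_e_mult)
  then have "(1 + inc_scale b ?E) * (1 - inc_scale b ?E) = 1"
    "(1 - inc_scale b ?E) * (1 + inc_scale b ?E) = 1"
    by (simp_all add: algebra_simps flip: inc_scale_mult)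
  then show ?thesis by (auto simp: ring_units_def)
qed

lemma conj_by_unipotent:
  fixes f :: "('x::{finite,linorder}, 'k::field) incidence"
  assumes "CARD('x) > 1"
  shows "conj_by (1 + inc_scale b (inc_e bt tp)) f
    = f + inc_scale (b * (inc_coeff f tp tp - inc_coeff f bt bt)) (inc_e bt tp)"
proof (rule conj_by_eqI[OF unipotent_unit[OF assms]])
  show "(1 + inc_scale b (inc_e bt tp)) * f
    = (f + inc_scale (b * (inc_coeff f tp tp - inc_coeff f bt bt)) (inc_e bt tp))
      * (1 + inc_scale b (inc_e bt tp))"
    using bt_less_tp[OF assms]
    by (simp add: distrib_left distrib_right bt_tp_mult mult_bt_tp inc_e_mult inc.scale_scale
        flip: inc_scale_mult)
     (simp add: algebra_simps inc.scale_left_diff_distrib)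
qed

text \<open>Each inner bracket lies in the radical, so the second hypothesis removes \<phi> from all
  three summands and leaves the Jacobi identity.\<close>

lemma regular_hom_lieI:
  fixes \<phi> :: "('x::{finite,order}, 'k::field) incidence \<Rightarrow> ('x, 'k) incidence"
  assumes "lie_automorphism inc_scale commutator \<phi>"
    and "\<And>f g. g \<in> inc_rad \<Longrightarrow> commutator g (\<phi> f) = commutator g f"
  shows "regular_hom_lie inc_scale commutator \<phi>"
proof -
  have "commutator (commutator a b) c + commutator (commutator b c) a + commutator (commutator c a) b = 0"
    for a b c :: "('x, 'k) incidence"
    by (simp add: commutator_def algebra_simps)
  then show ?thesis
    using assms by (simp add: regular_hom_lie_def commutator_in_rad)
qed


section \<open>Lie automorphisms of a chain and their central part\<close>

locale chain_lie_automorphism =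
  fixes \<phi> :: "('x::{finite,linorder}, 'k::field) incidence \<Rightarrow> ('x, 'k) incidence"
  assumes card_gt_1: "CARD('x) > 1"
    and lie_aut: "lie_automorphism inc_scale commutator \<phi>"
begin

lemma linear: "Vector_Spaces.linear inc_scale inc_scale \<phi>"
  and bij: "bij \<phi>"
  and brk: "\<phi> (commutator f g) = commutator (\<phi> f) (\<phi> g)"
  using lie_aut by (auto simp: lie_automorphism_def)

lemma phi_add: "\<phi> (f + g) = \<phi> f + \<phi> g"
  and phi_scale: "\<phi> (inc_scale c f) = inc_scale c (\<phi> f)"
  using linear by (simp_all add: linear_inc_iff)

lemma phi_zero: "\<phi> 0 = 0"
  using phi_add[of 0 0] by simp

lemma phi_minus: "\<phi> (- f) = - \<phi> f"
  using phi_add[of f "- f"] by (simp add: phi_zero eq_neg_iff_add_eq_0 add.commute)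

lemma phi_eq_0_iff: "\<phi> f = 0 \<longleftrightarrow> f = 0"
  using bij phi_zero by (metis bij_is_inj injD)

text \<open>For \<open>x < y\<close> the generator e_xy is the bracket of e_x with itself, and
  \<phi> maps brackets to brackets, which lie in the radical.\<close>

lemma phi_rad:
  assumes "f \<in> inc_rad"
  shows "\<phi> f \<in> inc_rad"
  using assms unfolding inc_rad_def
proof (induction rule: inc.span_induct_alt)
  case base
  then show ?case by (simp add: phi_zero inc.span_zero)
next
  case (step c g f)
  then obtain x y :: 'x where "g = inc_e x y" "x < y" by blast
  then have "g = commutator (inc_e x x) g"
    by (auto simp: commutator_e_diag)
  then have "\<phi> g \<in> inc_rad"
    by (metis brk commutator_in_rad)
  then show ?case
    using step by (simp add: phi_add phi_scale inc.span_add inc.span_scale inc_rad_def)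
qed

text \<open>The only candidate for \<nu>: conjugation fixes diagonal entries, so the scalar added by
  \<nu> can be read off at any diagonal position, here at \<open>tp\<close>.\<close>

definition central_part :: "('x, 'k) incidence \<Rightarrow> ('x, 'k) incidence" where
  "central_part f = inc_scale (inc_coeff (\<phi> f) tp tp - inc_coeff f tp tp) 1"

lemma central_radfree_central_part: "central_radfree central_part"
  unfolding central_radfree_def
proof (intro conjI allI ballI)
  show "Vector_Spaces.linear inc_scale inc_scale central_part"
    by (auto simp: linear_inc_iff central_part_def phi_add phi_scale algebra_simps
        intro!: incidence_eqI)
  show "central_part f \<in> ring_center UNIV" for f
    by (simp add: central_part_def ring_center_inc)
  show "central_part f = 0" if "f \<in> inc_rad" for f
    using that phi_rad[OF that] by (simp add: central_part_def inc_rad_iff)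
qed

lemma central_part_unique:
  assumes "\<beta> \<in> ring_units" "central_radfree \<nu>" "\<phi> = (\<lambda>f. conj_by \<beta> f + \<nu> f)"
  shows "\<nu> = central_part"
proof
  fix f
  obtain c where c: "\<nu> f = inc_scale c 1"
    using assms(2) by (auto simp: central_radfree_def ring_center_inc)
  have "inc_coeff (\<phi> f) tp tp = inc_coeff f tp tp + c"
    using assms(3) by (simp add: c inc_coeff_conj_by_diag[OF assms(1)])
  then show "\<nu> f = central_part f"
    by (simp add: central_part_def c)
qed

lemma eq_conj_by_plus_central_part:
  assumes "\<beta> \<in> ring_units"
    and "\<And>x. conj_by \<beta> (inc_e x x) = \<phi> (inc_e x x) - central_part (inc_e x x)"
    and "\<And>x y. x < y \<Longrightarrow> conj_by \<beta> (inc_e x y) = \<phi> (inc_e x y)"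
  shows "\<phi> = (\<lambda>f. conj_by \<beta> f + central_part f)"
proof -
  have lin: "Vector_Spaces.linear inc_scale inc_scale central_part"
    and rad: "f \<in> inc_rad \<Longrightarrow> central_part f = 0" for f
    using central_radfree_central_part by (auto simp: central_radfree_def)
  have "Vector_Spaces.linear inc_scale inc_scale (\<lambda>f. conj_by \<beta> f + central_part f)"
    using lin linear_conj_by[of \<beta>] by (simp add: linear_inc_iff inc.scale_right_distrib)
  with linear show ?thesis
  proof (rule linear_inc_eqI)
    show "\<phi> (inc_e x x) = conj_by \<beta> (inc_e x x) + central_part (inc_e x x)" for x
      by (simp add: assms(2))
    show "\<phi> (inc_e x y) = conj_by \<beta> (inc_e x y) + central_part (inc_e x y)" if "x < y" for x y
    proof -
      have "(inc_e x y :: ('x, 'k) incidence) \<in> inc_rad"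
        using that by (auto simp: inc_rad_iff)
      then show ?thesis
        by (simp add: rad assms(3)[OF that])
    qed
  qed
qed

text \<open>Conjugation turns e_tp into e_tp plus \<open>b\<close> times the corner element, while
  the central part changes only the diagonal. So \<phi> determines \<open>b\<close>, and with it
  \<beta>.\<close>

lemma unipotent_part_unique:
  assumes "\<phi> = (\<lambda>f. conj_by (1 + inc_scale b (inc_e bt tp)) f + central_part f)"
  shows "b = inc_coeff (\<phi> (inc_e tp tp)) bt tp"
  using bt_less_tp[OF card_gt_1]
  by (subst assms) (simp add: conj_by_unipotent[OF card_gt_1] central_part_def)

lemma regular_hom_lie_if_unipotent:
  assumes "\<phi> = (\<lambda>f. conj_by (1 + inc_scale b (inc_e bt tp)) f + central_part f)"
  shows "regular_hom_lie inc_scale commutator \<phi>"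
  using lie_aut
proof (rule regular_hom_lieI)
  fix f g :: "('x, 'k) incidence"
  assume g: "g \<in> inc_rad"
  obtain c z where z: "\<phi> f = f + inc_scale c 1 + z" "z \<in> ring_center inc_rad"
  proof
    show "\<phi> f = f + inc_scale (inc_coeff (\<phi> f) tp tp - inc_coeff f tp tp) 1
      + inc_scale (b * (inc_coeff f tp tp - inc_coeff f bt bt)) (inc_e bt tp)"
      by (subst assms)
        (simp add: conj_by_unipotent[OF card_gt_1] central_part_def add_ac)
  qed (unfold ring_center_inc_rad[OF card_gt_1], rule rangeI)
  have "commutator g z = 0"
    using z(2) g by (simp add: ring_center_def commutator_def)
  then show "commutator g (\<phi> f) = commutator g f"
    by (simp add: z(1) commutator_def algebra_simps flip: inc_scale_mult)
qed

lemma ex_unique_unipotent: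
  assumes "\<phi> = (\<lambda>f. conj_by (1 + inc_scale b (inc_e bt tp)) f + central_part f)"
  shows "\<exists>!(\<beta>, \<nu>). \<beta> \<in> ring_units \<and> inc_D \<beta> = 1 \<and> inc_J \<beta> \<in> ring_center inc_rad \<and>
                central_radfree \<nu> \<and> \<phi> = (\<lambda>f. conj_by \<beta> f + \<nu> f)"
proof (rule ex1I[of _ "(1 + inc_scale b (inc_e bt tp), central_part)"], goal_cases)
  case 1
  have "inc_D \<beta> = 1 \<and> inc_J \<beta> \<in> ring_center inc_rad"
    if "\<beta> = 1 + inc_scale b (inc_e bt tp)" for \<beta> :: "('x, 'k) incidence"
    using that normalized_iff[OF card_gt_1] by blast
  then show ?case
    using assms unipotent_unit[OF card_gt_1] central_radfree_central_part by simp
next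
  case (2 p)
  then obtain \<beta> \<nu> where p: "p = (\<beta>, \<nu>)" and \<beta>: "\<beta> \<in> ring_units"
    and \<nu>: "central_radfree \<nu>" and \<phi>: "\<phi> = (\<lambda>f. conj_by \<beta> f + \<nu> f)"
    and "inc_D \<beta> = 1 \<and> inc_J \<beta> \<in> ring_center inc_rad"
    by auto
  then obtain b' where b': "\<beta> = 1 + inc_scale b' (inc_e bt tp)"
    using normalized_iff[OF card_gt_1] by blast
  have \<nu>': "\<nu> = central_part"
    using \<beta> \<nu> \<phi> by (rule central_part_unique)
  have "b' = inc_coeff (\<phi> (inc_e tp tp)) bt tp"
    using \<phi> unfolding b' \<nu>' by (rule unipotent_part_unique)
  then have "b' = b"
    using unipotent_part_unique[OF assms] by (simp only:)
  then show ?case by (simp add: p b' \<nu>')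
qed


text \<open>By surjectivity every element is some \<open>\<phi> h\<close>, and \<open>1\<close>
  commutes with \<open>h\<close>.\<close>

lemma phi_one: "\<phi> 1 \<in> ring_center UNIV"
proof -
  have "commutator (\<phi> 1) g = 0" for g
  proof -
    obtain h where "g = \<phi> h" using bij by (metis bij_pointE)
    moreover have "commutator 1 h = 0" by (simp add: commutator_def)
    ultimately show ?thesis by (metis brk phi_zero)
  qed
  then show ?thesis by (simp add: ring_center_def commutator_eq_0_iff)
qed

lemma commutator_phi_e:
  assumes "k < l"
  shows "commutator (\<phi> (inc_e k k)) (\<phi> (inc_e k l)) = \<phi> (inc_e k l)"
    and "commutator (\<phi> (inc_e l l)) (\<phi> (inc_e k l)) = - \<phi> (inc_e k l)"
  using assms by (auto simp: commutator_e_diag phi_minus simp flip: brk)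

lemma phi_e_in_rad: "k < l \<Longrightarrow> \<phi> (inc_e k l) \<in> inc_rad"
  by (rule phi_rad) (auto simp: inc_rad_iff)

text \<open>The image of the corner element is a nonzero eigenvector, with eigenvalue 1, of
  bracketing with \<open>\<phi> (inc_e bt bt)\<close>.\<close>

lemma phi_e_bt_diag:
  obtains a b where "a < b"
    "inc_coeff (\<phi> (inc_e bt bt)) a a - inc_coeff (\<phi> (inc_e bt bt)) b b = 1"
proof -
  have "inc_coeff (inc_e bt tp) bt tp \<noteq> inc_coeff (0 :: ('x, 'k) incidence) bt tp"
    by simp
  then have "\<phi> (inc_e bt tp) \<noteq> 0"
    unfolding phi_eq_0_iff by metis
  then show thesis
    using eigenvalue_commutator[OF phi_e_in_rad _ commutator_phi_e(1)] bt_less_tp(1)[OF card_gt_1] that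
    by blast
qed

end

section \<open>Hom-Lie structures on chains with more than two elements\<close>

locale chain_hom_lie = chain_lie_automorphism +
  assumes card_gt_2: "CARD('a) > 2"
    and hom_lie: "commutator (commutator a b) (\<phi> c) + commutator (commutator b c) (\<phi> a)
      + commutator (commutator c a) (\<phi> b) = 0"
begin

text \<open>For e_k, e_j, e_kl the first two inner brackets are zero and the third is -e_kl, so one
  summand of the identity remains.\<close>

lemma phi_e_diag_commute:
  assumes "k < l" "j \<noteq> k" "j \<noteq> l"
  shows "\<phi> (inc_e j j) * inc_e k l = inc_e k l * \<phi> (inc_e j j)"
  using hom_lie[of "inc_e k k" "inc_e j j" "inc_e k l"] assms less_imp_neq[OF assms(1)]
  by (simp add: commutator_e_diag commutator_e_diag_right commutator_eq_0_iff)

text \<open>For e_i, e_j, e_ij the first inner bracket is zero and both others are -e_ij.\<close>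

lemma phi_e_diag_add_commute:
  assumes "i < j"
  shows "(\<phi> (inc_e i i) + \<phi> (inc_e j j)) * inc_e i j
    = inc_e i j * (\<phi> (inc_e i i) + \<phi> (inc_e j j))"
proof -
  have "- commutator (inc_e i j) (\<phi> (inc_e i i)) + - commutator (inc_e i j) (\<phi> (inc_e j j)) = 0"
    using hom_lie[of "inc_e i i" "inc_e j j" "inc_e i j"] less_imp_neq[OF assms]
    by (simp add: commutator_e_diag commutator_e_diag_right)
  then show ?thesis
    by (simp add: commutator_def algebra_simps)
qed

lemma phi_e_diag_const:
  assumes "k \<noteq> j" "l \<noteq> j"
  shows "inc_coeff (\<phi> (inc_e j j)) k k = inc_coeff (\<phi> (inc_e j j)) l l"
  using assms phi_e_diag_commute[of k l j] phi_e_diag_commute[of l k j]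
  by (cases k l rule: linorder_cases) (auto simp: commute_e_iff)

lemma phi_e_diag_diff:
  assumes "k \<noteq> j"
  shows "inc_coeff (\<phi> (inc_e j j)) j j - inc_coeff (\<phi> (inc_e j j)) k k = 1"
proof -
  obtain a b where ab: "a < b"
    "inc_coeff (\<phi> (inc_e bt bt)) a a - inc_coeff (\<phi> (inc_e bt bt)) b b = 1"
    by (rule phi_e_bt_diag)
  have "b \<noteq> bt" using ab(1) bt_le[of a] by auto
  \<comment> \<open>If \<open>a\<close> differed from \<open>bt\<close>, then
    \<open>phi_e_diag_const\<close> would make the difference in \<open>ab(2)\<close> zero; hence
    \<open>a = bt\<close>, and \<open>b\<close> may be replaced by any \<open>k\<close> other than
    \<open>bt\<close>.\<close>
  have bt: "inc_coeff (\<phi> (inc_e bt bt)) bt bt - inc_coeff (\<phi> (inc_e bt bt)) k k = 1"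
    if "k \<noteq> bt" for k
    using ab(2) phi_e_diag_const[of a bt b] phi_e_diag_const[of b bt k] \<open>b \<noteq> bt\<close> that
    by (cases "a = bt") auto
  show ?thesis
  proof (cases "j = bt")
    case True
    then show ?thesis using bt assms by simp
  next
    case False
    \<comment> \<open>The sum commutes with \<open>inc_e bt j\<close>, so its entries at
      \<open>bt\<close> and \<open>j\<close> agree; this carries the difference 1 from
      \<open>bt\<close> over to \<open>j\<close>.\<close>
    then have "inc_coeff (\<phi> (inc_e bt bt)) bt bt + inc_coeff (\<phi> (inc_e j j)) bt bt
      = inc_coeff (\<phi> (inc_e bt bt)) j j + inc_coeff (\<phi> (inc_e j j)) j j"
      using phi_e_diag_add_commute[of bt j] by (simp add: bt_less_iff commute_e_iff)
    moreover have "inc_coeff (\<phi> (inc_e j j)) k k = inc_coeff (\<phi> (inc_e j j)) bt bt"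
      using assms False by (intro phi_e_diag_const) auto
    ultimately show ?thesis
      using bt[OF False] by (simp add: algebra_simps)
  qed
qed

lemma phi_e_entries:
  assumes "a < b"
  shows "inc_coeff (\<phi> (inc_e i i)) a a * inc_coeff (\<phi> (inc_e j j)) a b
      + inc_coeff (\<phi> (inc_e i i)) a b * inc_coeff (\<phi> (inc_e j j)) b b
      + (\<Sum>z\<in>{a<..<b}. inc_coeff (\<phi> (inc_e i i)) a z * inc_coeff (\<phi> (inc_e j j)) z b)
    = inc_coeff (\<phi> (inc_e j j)) a a * inc_coeff (\<phi> (inc_e i i)) a b
      + inc_coeff (\<phi> (inc_e j j)) a b * inc_coeff (\<phi> (inc_e i i)) b b
      + (\<Sum>z\<in>{a<..<b}. inc_coeff (\<phi> (inc_e j j)) a z * inc_coeff (\<phi> (inc_e i i)) z b)"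
proof -
  have "commutator (inc_e i i) (inc_e j j) = (0 :: ('a, 'b) incidence)"
    by (simp add: commutator_e_diag)
  then have "\<phi> (inc_e i i) * \<phi> (inc_e j j) = \<phi> (inc_e j j) * \<phi> (inc_e i i)"
    by (metis brk phi_zero commutator_eq_0_iff)
  then have "inc_coeff (\<phi> (inc_e i i) * \<phi> (inc_e j j)) a b
      = inc_coeff (\<phi> (inc_e j j) * \<phi> (inc_e i i)) a b"
    by (rule arg_cong)
  then show ?thesis
    by (simp only: inc_coeff_mult_less[OF assms])
qed

lemma phi_e_off_diag_left:
  assumes "a < b" "b \<noteq> tp"
  shows "inc_coeff (\<phi> (inc_e j j)) a b = 0"
proof -
  \<comment> \<open>Commuting with \<open>inc_e b tp\<close> kills column \<open>b\<close> off the
    diagonal; the indices \<open>j = b\<close> and \<open>j = tp\<close> need other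
    arguments.\<close>
  have 1: "inc_coeff (\<phi> (inc_e j j)) a b = 0" if "a < b" "b \<noteq> tp" "j \<noteq> b" "j \<noteq> tp" for a b j
    using phi_e_diag_commute[of b tp j] that by (auto simp: less_tp_iff commute_e_iff)
  have "a \<noteq> b" "a \<noteq> tp" using assms le_tp[of b] by auto
  have sums: "(\<Sum>z\<in>{a<..<b}. inc_coeff (\<phi> (inc_e a a)) a z * inc_coeff (\<phi> (inc_e b b)) z b) = 0"
    "(\<Sum>z\<in>{a<..<b}. inc_coeff (\<phi> (inc_e b b)) a z * inc_coeff (\<phi> (inc_e a a)) z b) = 0"
    using assms \<open>a \<noteq> tp\<close> le_tp[of b] by (auto intro!: sum.neutral 1)
  \<comment> \<open>For \<open>j = b\<close>: in the relation between the images of e_a and e_b at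
    \<open>(a, b)\<close> only this term is left, and its first factor is 1 by
    \<open>phi_e_diag_diff\<close>.\<close>
  have "(inc_coeff (\<phi> (inc_e a a)) a a - inc_coeff (\<phi> (inc_e a a)) b b)
      * inc_coeff (\<phi> (inc_e b b)) a b = 0"
    using phi_e_entries[OF assms(1), of a b] 1[OF assms \<open>a \<noteq> b\<close> \<open>a \<noteq> tp\<close>]
    unfolding sums by (simp add: algebra_simps)
  then have 2: "inc_coeff (\<phi> (inc_e b b)) a b = 0"
    using phi_e_diag_diff[of b a] \<open>a \<noteq> b\<close> by simp
  \<comment> \<open>For \<open>j = tp\<close>: the sum of the images of e_b and e_tp commutes with
    \<open>inc_e b tp\<close>, so its entry at \<open>(a, b)\<close> is zero.\<close>
  have "inc_coeff (\<phi> (inc_e tp tp)) a b = 0"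
    using phi_e_diag_add_commute[of b tp] 2 assms \<open>a \<noteq> b\<close>
    by (auto simp: less_tp_iff commute_e_iff)
  then show ?thesis
    using 1[OF assms] 2 by (cases "j = b"; cases "j = tp") simp_all
qed

text \<open>Mirror image of \<open>phi_e_off_diag_left\<close>, with rows for columns and
  \<open>bt\<close> for \<open>tp\<close>.\<close>

lemma phi_e_off_diag_right:
  assumes "a < b" "a \<noteq> bt"
  shows "inc_coeff (\<phi> (inc_e j j)) a b = 0"
proof -
  have 1: "inc_coeff (\<phi> (inc_e j j)) a b = 0" if "a < b" "a \<noteq> bt" "j \<noteq> a" "j \<noteq> bt" for a b j
    using phi_e_diag_commute[of bt a j] that by (auto simp: bt_less_iff commute_e_iff)
  have "b \<noteq> a" "b \<noteq> bt" using assms bt_le[of a] by auto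
  have sums: "(\<Sum>z\<in>{a<..<b}. inc_coeff (\<phi> (inc_e a a)) a z * inc_coeff (\<phi> (inc_e b b)) z b) = 0"
    "(\<Sum>z\<in>{a<..<b}. inc_coeff (\<phi> (inc_e b b)) a z * inc_coeff (\<phi> (inc_e a a)) z b) = 0"
    using assms \<open>b \<noteq> bt\<close> bt_le[of a] by (auto intro!: sum.neutral 1)
  have "(inc_coeff (\<phi> (inc_e b b)) b b - inc_coeff (\<phi> (inc_e b b)) a a)
      * inc_coeff (\<phi> (inc_e a a)) a b = 0"
    using phi_e_entries[OF assms(1), of a b] 1[OF assms \<open>b \<noteq> a\<close> \<open>b \<noteq> bt\<close>]
    unfolding sums by (simp add: algebra_simps)
  then have 2: "inc_coeff (\<phi> (inc_e a a)) a b = 0"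
    using phi_e_diag_diff[of a b] \<open>b \<noteq> a\<close> by simp
  have "inc_coeff (\<phi> (inc_e bt bt)) a b = 0"
    using phi_e_diag_add_commute[of bt a] 2 assms \<open>b \<noteq> a\<close>
    by (auto simp: bt_less_iff commute_e_iff)
  then show ?thesis
    using 1[OF assms] 2 by (cases "j = a"; cases "j = bt") simp_all
qed

text \<open>Comes from the commutation of the images of e_bt and e_j at \<open>(bt, tp)\<close>,
  where the intermediate terms vanish. This is the pattern of corner entries that conjugation by
  \<open>1 + inc_scale b (inc_e bt tp)\<close> produces.\<close>

lemma phi_e_bt_tp:
  assumes "j \<noteq> bt"
  shows "inc_coeff (\<phi> (inc_e j j)) bt tp
    = (if j = tp then - inc_coeff (\<phi> (inc_e bt bt)) bt tp else 0)"
proof -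
  have sums: "(\<Sum>z\<in>{bt<..<tp}. inc_coeff (\<phi> (inc_e i i)) bt z * inc_coeff (\<phi> (inc_e k k)) z tp) = 0" for i k
    by (auto intro!: sum.neutral phi_e_off_diag_left)
  have "(inc_coeff (\<phi> (inc_e bt bt)) bt bt - inc_coeff (\<phi> (inc_e bt bt)) tp tp)
      * inc_coeff (\<phi> (inc_e j j)) bt tp
    = - (inc_coeff (\<phi> (inc_e j j)) tp tp - inc_coeff (\<phi> (inc_e j j)) bt bt)
      * inc_coeff (\<phi> (inc_e bt bt)) bt tp"
    using phi_e_entries[OF bt_less_tp(1)[OF card_gt_1], of bt j]
    unfolding sums by (simp add: algebra_simps)
  moreover have "inc_coeff (\<phi> (inc_e bt bt)) bt bt - inc_coeff (\<phi> (inc_e bt bt)) tp tp = 1"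
    by (rule phi_e_diag_diff) (rule bt_less_tp(3)[OF card_gt_1])
  moreover have "inc_coeff (\<phi> (inc_e j j)) tp tp - inc_coeff (\<phi> (inc_e j j)) bt bt
    = (if j = tp then 1 else 0)"
    using phi_e_diag_diff[of bt j] phi_e_diag_const[of tp j bt] assms by auto
  ultimately show ?thesis by simp
qed

lemma phi_e_diag:
  "\<phi> (inc_e j j) - central_part (inc_e j j)
    = inc_e j j + inc_scale (inc_coeff (\<phi> (inc_e j j)) bt tp) (inc_e bt tp)"
proof (rule incidence_eqI)
  fix a b
  have "inc_coeff (\<phi> (inc_e j j)) a b = 0" if "a \<noteq> b" "a \<noteq> bt \<or> b \<noteq> tp"
    using that phi_e_off_diag_left[of a b j] phi_e_off_diag_right[of a b j]
    by (cases a b rule: linorder_cases) (auto simp: inc_coeff_zero)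
  moreover have "inc_coeff (\<phi> (inc_e j j)) a a - inc_coeff (\<phi> (inc_e j j)) tp tp
    = (if a = j then 1 else 0) - (if tp = j then 1 else 0)"
    using phi_e_diag_diff[of tp a] phi_e_diag_diff[of a tp] phi_e_diag_const[of a j tp]
    by (cases "a = j"; cases "tp = j") (simp_all add: algebra_simps)
  ultimately show "inc_coeff (\<phi> (inc_e j j) - central_part (inc_e j j)) a b
    = inc_coeff (inc_e j j + inc_scale (inc_coeff (\<phi> (inc_e j j)) bt tp) (inc_e bt tp)) a b"
    using bt_less_tp[OF card_gt_1] by (auto simp: central_part_def algebra_simps)
qed

lemma commutator_phi_e_diag:
  assumes "g \<in> inc_rad"
  shows "commutator (\<phi> (inc_e j j)) g = commutator (inc_e j j) g"
proof -
  define z where "z = inc_scale (inc_coeff (\<phi> (inc_e j j)) bt tp) (inc_e bt tp :: ('a, 'b) incidence)"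
  have "z \<in> ring_center inc_rad"
    by (auto simp: z_def ring_center_inc_rad[OF card_gt_1])
  then have z: "z * g = g * z"
    using assms by (simp add: ring_center_def)
  obtain c where c: "central_part (inc_e j j) = inc_scale c 1"
    by (simp add: central_part_def)
  have "\<phi> (inc_e j j) = inc_e j j + z + inc_scale c 1"
    using phi_e_diag[of j] by (simp add: c z_def diff_eq_eq)
  then show ?thesis
    by (simp add: commutator_def algebra_simps z flip: inc_scale_mult)
qed

lemma phi_e_scale:
  assumes "k < l"
  shows "\<phi> (inc_e k l) = inc_scale (inc_coeff (\<phi> (inc_e k l)) k l) (inc_e k l)"
proof (rule incidence_eqI)
  fix a b
  let ?G = "\<phi> (inc_e k l)"
  have rad: "?G \<in> inc_rad" by (rule phi_e_in_rad[OF assms])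
  have "commutator (inc_e k k) ?G = ?G" "commutator (inc_e l l) ?G = - ?G"
    using commutator_phi_e[OF assms] commutator_phi_e_diag[OF rad] by auto
  from this[THEN arg_cong[of _ _ "\<lambda>f. inc_coeff f a b"]]
  have 1: "(if a = k then inc_coeff ?G a b else 0) - (if b = k then inc_coeff ?G a b else 0) = inc_coeff ?G a b"
    and 2: "(if a = l then inc_coeff ?G a b else 0) - (if b = l then inc_coeff ?G a b else 0) = - inc_coeff ?G a b"
    by (simp_all add: inc_coeff_commutator_e_diag)
  have "inc_coeff ?G a b = 0" if "\<not> a < b"
    using that rad inc_coeff_zero[of a b ?G] by (cases "a = b") (auto simp: inc_rad_iff)
  then show "inc_coeff ?G a b = inc_coeff (inc_scale (inc_coeff ?G k l) (inc_e k l)) a b"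
    using 1 2 assms by (auto split: if_splits)
qed

lemma phi_e:
  assumes "k < l"
  shows "\<phi> (inc_e k l) = inc_e k l"
proof -
  have up: "\<phi> (inc_e k l) = inc_e k l" if "k < l" "l \<noteq> tp" for k l
  proof -
    obtain c where c: "\<phi> (inc_e k l) = inc_scale c (inc_e k l)"
      using phi_e_scale[OF \<open>k < l\<close>] by blast
    have "l < tp" using that(2) by (simp add: less_tp_iff)
    then have "k < tp" using that(1) by simp
    have "k \<noteq> tp" "l \<noteq> tp" using \<open>k < tp\<close> \<open>l < tp\<close> by auto
    have "commutator (inc_e k tp) (\<phi> (inc_e tp tp)) = inc_e k tp"
      using \<open>k < tp\<close> by (subst commutator_swap)
        (auto simp: commutator_phi_e_diag inc_rad_iff commutator_e_diag)
    moreover have "commutator (inc_e l tp) (inc_e k l) = - (inc_e k tp :: ('a, 'b) incidence)"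
      using \<open>l < tp\<close> \<open>k < tp\<close> that(1)
      by (subst commutator_swap) (simp add: commutator_e_e)
    \<comment> \<open>The inner brackets are 0, \<open>inc_e k tp\<close> and
      \<open>inc_e l tp\<close>; the last two summands are \<open>inc_e k tp\<close> and its
      multiple by \<open>- c\<close>.\<close>
    ultimately have "inc_scale c (inc_e k tp) = (inc_e k tp :: ('a, 'b) incidence)"
      using hom_lie[of "inc_e tp tp" "inc_e k l" "inc_e l tp"] that(1) \<open>l < tp\<close> \<open>k \<noteq> tp\<close> \<open>l \<noteq> tp\<close>
        less_imp_neq[OF that(1)]
      by (simp add: c commutator_e_diag commutator_e_diag_right commutator_e_e commutator_scale)
    from arg_cong[OF this, of "\<lambda>f. inc_coeff f k tp"]
    show ?thesis by (simp add: c)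
  qed
  have down: "\<phi> (inc_e k l) = inc_e k l" if "k < l" "k \<noteq> bt" for k l
  proof -
    obtain c where c: "\<phi> (inc_e k l) = inc_scale c (inc_e k l)"
      using phi_e_scale[OF \<open>k < l\<close>] by blast
    have "bt < k" using that(2) by (simp add: bt_less_iff)
    then have "bt < l" using that(1) by simp
    have "k \<noteq> bt" "l \<noteq> bt" using \<open>bt < k\<close> \<open>bt < l\<close> by auto
    have "commutator (inc_e bt l) (\<phi> (inc_e bt bt)) = - inc_e bt l"
      using \<open>bt < l\<close> by (subst commutator_swap)
        (auto simp: commutator_phi_e_diag inc_rad_iff commutator_e_diag)
    then have "inc_scale c (inc_e bt l) = (inc_e bt l :: ('a, 'b) incidence)"
      using hom_lie[of "inc_e bt bt" "inc_e bt k" "inc_e k l"] that(1) \<open>bt < k\<close> \<open>bt < l\<close>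
        \<open>l \<noteq> bt\<close> \<open>k \<noteq> bt\<close> less_imp_neq[OF that(1)]
      by (simp add: c commutator_e_diag commutator_e_diag_right commutator_e_e commutator_scale)
    from arg_cong[OF this, of "\<lambda>f. inc_coeff f bt l"]
    show ?thesis by (simp add: c)
  qed
  show ?thesis
  proof (cases "l \<noteq> tp \<or> k \<noteq> bt")
    case True
    then show ?thesis using up down assms by blast
  next
    case False
    \<comment> \<open>The corner element has no room beyond its ends, but a third element
      \<open>m\<close> makes it a bracket of two elements already known to be fixed.\<close>
    have "\<not> (UNIV :: 'a set) \<subseteq> {bt, tp}"
    proof
      assume "(UNIV :: 'a set) \<subseteq> {bt, tp}"
      then have "CARD('a) \<le> card {bt, tp :: 'a}" by (intro card_mono) auto
      then show False using card_gt_2 bt_less_tp[OF card_gt_1] by simp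
    qed
    then obtain m :: 'a where m: "bt < m" "m < tp"
      by (auto simp: bt_less_iff less_tp_iff)
    then have *: "commutator (inc_e bt m) (inc_e m tp) = (inc_e bt tp :: ('a, 'b) incidence)"
      using bt_less_tp[OF card_gt_1] by (simp add: commutator_e_e)
    have "\<phi> (inc_e bt m) = inc_e bt m" "\<phi> (inc_e m tp) = inc_e m tp"
      using m up[of bt m] down[of m tp] by auto
    then show ?thesis
      using brk[of "inc_e bt m" "inc_e m tp"] False by (simp add: *)
  qed
qed

lemma eq_unipotent:
  "\<phi> = (\<lambda>f. conj_by (1 + inc_scale (inc_coeff (\<phi> (inc_e tp tp)) bt tp) (inc_e bt tp)) f + central_part f)"
proof -
  define b where "b = inc_coeff (\<phi> (inc_e tp tp)) bt tp"
  note neq = bt_less_tp[OF card_gt_1]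
  have b: "b = - inc_coeff (\<phi> (inc_e bt bt)) bt tp"
    unfolding b_def by (subst phi_e_bt_tp[OF neq(3)]) simp
  \<comment> \<open>These are the corner entries of the conjugates of the e_x by
    \<open>1 + inc_scale b (inc_e bt tp)\<close>.\<close>
  have x: "inc_coeff (\<phi> (inc_e x x)) bt tp = (if x = tp then b else if x = bt then - b else 0)" for x
    using phi_e_bt_tp[of x] by (cases "x = bt") (simp_all add: neq b)
  have "\<phi> = (\<lambda>f. conj_by (1 + inc_scale b (inc_e bt tp)) f + central_part f)"
  proof (rule eq_conj_by_plus_central_part)
    fix x y :: 'a
    show "1 + inc_scale b (inc_e bt tp) \<in> (ring_units :: ('a, 'b) incidence set)"
      by (rule unipotent_unit[OF card_gt_1])
    show "conj_by (1 + inc_scale b (inc_e bt tp)) (inc_e x x)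
        = \<phi> (inc_e x x) - central_part (inc_e x x)"
      unfolding phi_e_diag x conj_by_unipotent[OF card_gt_1] using neq by auto
    show "conj_by (1 + inc_scale b (inc_e bt tp)) (inc_e x y) = \<phi> (inc_e x y)" if "x < y"
      unfolding conj_by_unipotent[OF card_gt_1] phi_e[OF that] using that by auto
  qed
  then show ?thesis unfolding b_def .
qed

end

section \<open>The two-element chain\<close>

locale two_chain_lie_automorphism = chain_lie_automorphism +
  assumes card_2: "CARD('a) = 2"
begin

lemma UNIV_two: "(UNIV :: 'a set) = {bt, tp}"
proof -
  have "card {bt, tp :: 'a} = CARD('a)"
    using card_2 bt_less_tp[OF card_gt_1] by simp
  then show ?thesis
    by (intro card_subset_eq[symmetric]) auto
qed

lemma two_cases: "x = bt \<or> x = tp" for x :: 'a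
  using UNIV_two by blast

lemma two_eqI:
  assumes "inc_coeff f bt bt = inc_coeff g bt bt" "inc_coeff f bt tp = inc_coeff g bt tp"
    "inc_coeff f tp tp = inc_coeff g tp tp"
  shows "f = (g :: ('a, 'b) incidence)"
proof (rule incidence_eqI)
  fix x y
  show "inc_coeff f x y = inc_coeff g x y"
    using assms two_cases[of x] two_cases[of y] bt_less_tp[OF card_gt_1] by auto
qed

lemma two_mult:
  fixes f g :: "('a, 'b) incidence"
  shows "inc_coeff (f * g) bt tp
    = inc_coeff f bt bt * inc_coeff g bt tp + inc_coeff f bt tp * inc_coeff g tp tp"
proof -
  have "{bt<..<tp :: 'a} = {}"
    using two_cases by (auto simp: set_eq_iff) (metis less_irrefl)
  then show ?thesis
    by (simp add: inc_coeff_mult_less[OF bt_less_tp(1)[OF card_gt_1]])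
qed

lemma eq_conj:
  obtains \<beta> where "\<beta> \<in> ring_units" "\<phi> = (\<lambda>f. conj_by \<beta> f + central_part f)"
proof -
  note neq = bt_less_tp[OF card_gt_1]
  define d where "d = inc_coeff (\<phi> (inc_e bt tp)) bt tp"
  define r where "r = inc_coeff (\<phi> (inc_e bt bt)) bt tp"
  have E: "\<phi> (inc_e bt tp) = inc_scale d (inc_e bt tp)"
    using phi_e_in_rad[OF neq(1)] neq
    by (intro two_eqI) (auto simp: d_def inc_rad_iff)
  have "d \<noteq> 0"
  proof
    assume "d = 0"
    then have "inc_e bt tp = (0 :: ('a, 'b) incidence)"
      using E by (simp add: phi_eq_0_iff)
    from arg_cong[OF this, of "\<lambda>f. inc_coeff f bt tp"] show False by simp
  qed
  obtain a b where ab: "a < b"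
    "inc_coeff (\<phi> (inc_e bt bt)) a a - inc_coeff (\<phi> (inc_e bt bt)) b b = 1"
    by (rule phi_e_bt_diag)
  then have "a = bt" "b = tp"
    using two_cases[of a] two_cases[of b] by auto
  with ab have diag: "inc_coeff (\<phi> (inc_e bt bt)) bt bt = inc_coeff (\<phi> (inc_e bt bt)) tp tp + 1"
    by (simp add: algebra_simps)
  have "inc_e tp tp = (1 - inc_e bt bt :: ('a, 'b) incidence)"
    using neq by (intro two_eqI) auto
  then have "inc_e tp tp + inc_e bt bt = (1 :: ('a, 'b) incidence)" by simp
  \<comment> \<open>Since \<open>\<phi> 1\<close> is a scalar, the image of e_tp is known from that
    of e_bt.\<close>
  then have "\<phi> (inc_e tp tp) = \<phi> 1 - \<phi> (inc_e bt bt)"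
    using phi_add[of "inc_e tp tp" "inc_e bt bt"] by simp
  moreover obtain c where "\<phi> 1 = inc_scale c 1"
    using phi_one by (auto simp: ring_center_inc)
  ultimately have tp: "\<phi> (inc_e tp tp) = inc_scale c 1 - \<phi> (inc_e bt bt)" by simp
  \<comment> \<open>The matrix with rows \<open>(d, -r)\<close> and \<open>(0, 1)\<close>:
    conjugation by it scales the corner element by \<open>d\<close> and sends e_bt to e_bt plus
    \<open>r\<close> times the corner element. Its inverse is \<beta>'.\<close>
  define \<beta> :: "('a, 'b) incidence" where
    "\<beta> = inc_scale d (inc_e bt bt) + inc_e tp tp - inc_scale r (inc_e bt tp)"
  define \<beta>' :: "('a, 'b) incidence" where
    "\<beta>' = inc_scale (1 / d) (inc_e bt bt) + inc_e tp tp + inc_scale (r / d) (inc_e bt tp)"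
  have "\<beta> * \<beta>' = 1" "\<beta>' * \<beta> = 1"
    using neq \<open>d \<noteq> 0\<close>
    by (intro two_eqI; simp add: inc_coeff_mult_diag two_mult \<beta>_def \<beta>'_def)+
  then have \<beta>: "\<beta> \<in> ring_units" by (auto simp: ring_units_def)
  have bt_e: "conj_by \<beta> (inc_e bt bt) = \<phi> (inc_e bt bt) - central_part (inc_e bt bt)"
    using neq diag
    by (intro conj_by_eqI[OF \<beta>] two_eqI)
      (simp_all add: inc_coeff_mult_diag two_mult \<beta>_def central_part_def r_def algebra_simps)
  have tp_e: "conj_by \<beta> (inc_e tp tp) = \<phi> (inc_e tp tp) - central_part (inc_e tp tp)"
    using neq diag
    by (intro conj_by_eqI[OF \<beta>] two_eqI)
      (simp_all add: tp inc_coeff_mult_diag two_mult \<beta>_def central_part_def r_def algebra_simps)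
  have bt_tp: "conj_by \<beta> (inc_e bt tp) = \<phi> (inc_e bt tp)"
    using neq
    by (intro conj_by_eqI[OF \<beta>] two_eqI)
      (simp_all add: E inc_coeff_mult_diag two_mult \<beta>_def)
  have "\<phi> = (\<lambda>f. conj_by \<beta> f + central_part f)"
  proof (rule eq_conj_by_plus_central_part[OF \<beta>])
    show "conj_by \<beta> (inc_e x x) = \<phi> (inc_e x x) - central_part (inc_e x x)" for x
      using two_cases[of x] bt_e tp_e by auto
    show "conj_by \<beta> (inc_e x y) = \<phi> (inc_e x y)" if "x < y" for x y
      using two_cases[of x] two_cases[of y] bt_tp that by auto
  qed
  with \<beta> show thesis by (rule that)
qed

lemma regular_hom_lie: "regular_hom_lie inc_scale commutator \<phi>"
  using lie_aut
proof (rule regular_hom_lieI)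
  fix f g :: "('a, 'b) incidence"
  assume g: "g \<in> inc_rad"
  obtain \<beta> where \<beta>: "\<beta> \<in> ring_units" "\<phi> = (\<lambda>f. conj_by \<beta> f + central_part f)"
    by (rule eq_conj)
  have "\<phi> f = conj_by \<beta> f + central_part f"
    using \<beta>(2) by (rule fun_cong)
  moreover obtain c where "central_part f = inc_scale c 1"
    by (simp add: central_part_def)
  ultimately have "inc_coeff (\<phi> f) a a = inc_coeff f a a + c" for a
    by (simp add: inc_coeff_conj_by_diag[OF \<beta>(1)])
  then have "inc_coeff (\<phi> f) tp tp - inc_coeff (\<phi> f) bt bt = inc_coeff f tp tp - inc_coeff f bt bt"
    by simp
  \<comment> \<open>As \<open>g\<close> has only a corner entry, this product is the corner entry of
    its commutator with \<open>\<phi> f\<close>, and the right side is the one for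
    \<open>f\<close>.\<close>
  then have "inc_coeff g bt tp * (inc_coeff (\<phi> f) tp tp - inc_coeff (\<phi> f) bt bt)
      = inc_coeff g bt tp * (inc_coeff f tp tp - inc_coeff f bt bt)"
    by simp
  then show "commutator g (\<phi> f) = commutator g f"
    using g by (intro two_eqI)
      (simp_all add: commutator_def inc_coeff_mult_diag two_mult inc_rad_iff algebra_simps)
qed

end

text \<open>For more than two elements the pair of \<beta> and \<nu> is unique. For two elements
  \<beta> may be any unit, so uniqueness is stated for \<nu> alone; there both sides hold for every
  Lie automorphism.\<close>

theorem corollary2p14:
  fixes \<phi> :: "('x::{finite,linorder}, 'k::field) incidence \<Rightarrow> ('x, 'k) incidence"
  assumes "CARD('x) > 1"
    and "lie_automorphism inc_scale commutator \<phi>"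
  shows "(CARD('x) > 2 \<longrightarrow>
           (regular_hom_lie inc_scale commutator \<phi> \<longleftrightarrow>
             (\<exists>!(\<beta>, \<nu>). \<beta> \<in> ring_units \<and> inc_D \<beta> = 1 \<and> inc_J \<beta> \<in> ring_center inc_rad \<and>
                central_radfree \<nu> \<and> \<phi> = (\<lambda>f. conj_by \<beta> f + \<nu> f))))
       \<and> (CARD('x) = 2 \<longrightarrow>
           (regular_hom_lie inc_scale commutator \<phi> \<longleftrightarrow>
             (\<exists>!\<nu>. central_radfree \<nu> \<and>
                (\<exists>\<beta>\<in>ring_units. \<phi> = (\<lambda>f. conj_by \<beta> f + \<nu> f)))))"
proof -
  interpret chain_lie_automorphism \<phi>
    using assms by unfold_locales
  show ?thesis
  proof (intro conjI impI iffI)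
    assume "CARD('x) > 2" "regular_hom_lie inc_scale commutator \<phi>"
    then interpret chain_hom_lie \<phi>
      by unfold_locales (auto simp: regular_hom_lie_def)
    show "\<exists>!(\<beta>, \<nu>). \<beta> \<in> ring_units \<and> inc_D \<beta> = 1 \<and> inc_J \<beta> \<in> ring_center inc_rad \<and>
                central_radfree \<nu> \<and> \<phi> = (\<lambda>f. conj_by \<beta> f + \<nu> f)"
      by (rule ex_unique_unipotent[OF eq_unipotent])
  next
    assume "\<exists>!(\<beta>, \<nu>). \<beta> \<in> ring_units \<and> inc_D \<beta> = 1 \<and> inc_J \<beta> \<in> ring_center inc_rad \<and>
                central_radfree \<nu> \<and> \<phi> = (\<lambda>f. conj_by \<beta> f + \<nu> f)"
    then obtain \<beta> \<nu> where \<beta>: "\<beta> \<in> ring_units" "inc_D \<beta> = 1 \<and> inc_J \<beta> \<in> ring_center inc_rad"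
      and \<nu>: "central_radfree \<nu>" and \<phi>: "\<phi> = (\<lambda>f. conj_by \<beta> f + \<nu> f)"
      by blast
    obtain b where b: "\<beta> = 1 + inc_scale b (inc_e bt tp)"
      using \<beta>(2) unfolding normalized_iff[OF assms(1)] by blast
    show "regular_hom_lie inc_scale commutator \<phi>"
      using \<phi> unfolding b central_part_unique[OF \<beta>(1) \<nu> \<phi>]
      by (rule regular_hom_lie_if_unipotent)
  next
    assume "CARD('x) = 2"
    then interpret two_chain_lie_automorphism \<phi>
      by unfold_locales
    obtain \<beta> where \<beta>: "\<beta> \<in> ring_units" "\<phi> = (\<lambda>f. conj_by \<beta> f + central_part f)"
      by (rule eq_conj)
    show "\<exists>!\<nu>. central_radfree \<nu> \<and> (\<exists>\<beta>\<in>ring_units. \<phi> = (\<lambda>f. conj_by \<beta> f + \<nu> f))"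
      using central_radfree_central_part \<beta> central_part_unique by blast
  next
    assume "CARD('x) = 2"
    then interpret two_chain_lie_automorphism \<phi>
      by unfold_locales
    show "regular_hom_lie inc_scale commutator \<phi>"
      by (rule regular_hom_lie)
  qed
qed

end
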